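(* For each positive integer $n$, define a map $V$ on $C(n)$ as follows. Given $c\in C(n)$, append a final part $0$ if $c$ has odd length, so that $c=(c_1,\ldots,c_{2u})$. Replace each pair $(c_{2i-1},c_{2i})$, $1\le i\le u$, by \[ \begin{cases} (1^{c_{2i-1}-c_{2i}},\,2c_{2i}) & \text{if } c_{2i}-c_{2i-1}<1,\\ (1^{c_{2i-1}+c_{2i}-2k-1},\,2k+1) & \text{if } 2k-1 \le c_{2i}-c_{2i-1} < 2k+1 \text{ for an integer } k\ge 1,\end{cases}\] where a resulting part $0$ (when $c_{2i}=0$) is omitted, and let $V(c)$ be the concatenation of these blocks in order. Then $V$ is a permutation (bijection) of $C(n)$.
   Context: $C(n)$ is the set of compositions of $n$, i.e., finite sequences of positive integers summing to $n$. $1^m$ denotes $m$ consecutive parts equal to $1$ (nothing if $m=0$). *)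

theory Defs
  imports Main
begin

definition compositions :: "nat \<Rightarrow> nat list set" where
  "compositions n = {c. (\<forall>x \<in> set c. 0 < x) \<and> sum_list c = n}"

definition pad_even :: "nat list \<Rightarrow> nat list" where
  "pad_even c = (if odd (length c) then c @ [0] else c)"

definition block_index :: "nat \<Rightarrow> nat \<Rightarrow> nat" where
  "block_index a b =
     (THE k. 1 \<le> k \<and> 2 * int k - 1 \<le> int b - int a \<and> int b - int a < 2 * int k + 1)"

lemma block_index_eq:
  assumes "a < b"
  shows "block_index a b = (b - a + 1) div 2"
  unfolding block_index_def
  using assms by (intro the_equality) presburger+

(* The subtractions on nat below are never truncated when a \<ge> 1: in the first branch b \<le> a;
   in the second, with k = block_index a b, a + b - (2k + 1) \<ge> 2a - 2 \<ge> 0. *)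
definition block :: "nat \<Rightarrow> nat \<Rightarrow> nat list" where
  "block a b =
     (if int b - int a < 1
      then replicate (a - b) 1 @ (if b = 0 then [] else [2 * b])
      else (let k = block_index a b
            in replicate (a + b - (2 * k + 1)) 1 @ [2 * k + 1]))"

(* Lists are indexed from 0, so the i-th pair (i < u) is (d ! (2 * i), d ! (2 * i + 1)). *)
definition V :: "nat list \<Rightarrow> nat list" where
  "V c = (let d = pad_even c
          in concat (map (\<lambda>i. block (d ! (2 * i)) (d ! (2 * i + 1))) [0..<length d div 2]))"

end

(* Every block of a full pair is a run of ones followed by exactly one part greater than 1, and the
   pair can be read off from the length of the run and that part, its parity telling the two cases
   apart; an unpaired last part becomes a final run of ones. Hence V is injective, and therefore
   bijective because the set of compositions of n is finite. *)
theory Submission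
  imports Defs
begin

lemma finite_compositions: "finite (compositions n)"
proof (rule finite_subset)
  have "length c \<le> sum_list c" if "\<forall>x\<in>set c. 0 < x" for c :: "nat list"
    using that by (induction c) auto
  then show "compositions n \<subseteq> {c. set c \<subseteq> {..n} \<and> length c \<le> n}"
    by (auto simp: compositions_def member_le_sum_list)
  show "finite {c. set c \<subseteq> {..n} \<and> length c \<le> n}"
    by (rule finite_lists_length_le) simp
qed

text \<open>The first entry different from \<open>z\<close> marks where the run ends, so run length,
  marker and remainder can be read off uniquely.\<close>

lemma replicate_append_Cons_eq_iff:
  assumes "x \<noteq> z" "y \<noteq> z"
  shows "replicate m z @ x # r = replicate k z @ y # s \<longleftrightarrow> m = k \<and> x = y \<and> r = s"
proof (induction m arbitrary: k)
  case 0
  then show ?case using assms by (cases k) auto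
next
  case (Suc m)
  then show ?case using assms by (cases k) auto
qed

text \<open>Distinguishes the image of a list starting with a full pair from that of a single
  leftover part.\<close>

lemma replicate_append_Cons_neq_replicate:
  assumes "x \<noteq> z"
  shows "replicate m z @ x # r \<noteq> replicate k z"
  using assms by (metis in_set_conv_decomp in_set_replicate)

text \<open>\<open>run\<close> and \<open>big_part\<close> encode a block by two numbers, with
  \<open>block_index\<close> replaced by its closed form. For \<open>b = 0\<close> the value
  \<open>big_part a b = 0\<close> stands for the omitted part.\<close>

definition run :: "nat \<Rightarrow> nat \<Rightarrow> nat" where
  "run a b = (if b \<le> a then a - b else a + b - (2 * ((b - a + 1) div 2) + 1))"

definition big_part :: "nat \<Rightarrow> nat \<Rightarrow> nat" where
  "big_part a b = (if b \<le> a then 2 * b else 2 * ((b - a + 1) div 2) + 1)"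

lemma block_eq_run:
  assumes "0 < b"
  shows "block a b = replicate (run a b) 1 @ [big_part a b]"
  using assms by (auto simp: block_def run_def big_part_def block_index_eq Let_def)

lemma block_0 [simp]: "block a 0 = replicate a 1"
  by (simp add: block_def)

lemma big_part_gt_1:
  assumes "0 < b"
  shows "1 < big_part a b"
  using assms by (auto simp: big_part_def div_greater_zero_iff)

lemma run_add_big_part:
  assumes "0 < a"
  shows "run a b + big_part a b = a + b"
proof (cases "b \<le> a")
  case False
  have "2 * ((b - a + 1) div 2) \<le> b - a + 1"
    by (rule times_div_less_eq_dividend)
  \<comment> \<open>Here \<open>a \<ge> 1\<close> gives \<open>b - a + 2 \<le> a + b\<close>, so the
    subtraction in \<open>run\<close> is not truncated.\<close>
  with assms False have "2 * ((b - a + 1) div 2) + 1 \<le> a + b"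
    by linarith
  with False show ?thesis
    by (simp add: run_def big_part_def)
qed (simp add: run_def big_part_def)

lemma run_big_part_inject:
  assumes "0 < a" "0 < a'" "run a b = run a' b'" "big_part a b = big_part a' b'"
  shows "a = a' \<and> b = b'"
proof -
  have sum: "a + b = a' + b'"
    using assms run_add_big_part by metis
  have parity: "even (big_part x y) \<longleftrightarrow> y \<le> x" for x y
    by (simp add: big_part_def)
  show ?thesis
  proof (cases "b \<le> a")
    case True
    then have "b' \<le> a'"
      using assms(4) parity by metis
    with True assms(4) sum show ?thesis by (simp add: big_part_def)
  next
    case False
    then have "\<not> b' \<le> a'"
      using assms(4) parity by metis
    with False assms(4) have half: "(b - a + 1) div 2 = (b' - a' + 1) div 2"
      by (simp add: big_part_def)
    obtain e e' where e: "b = a + e" "b' = a' + e'"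
      using False \<open>\<not> b' \<le> a'\<close> by (metis le_add_diff_inverse nat_le_linear)
    have "2 * a + e = 2 * a' + e'" "(e + 1) div 2 = (e' + 1) div 2"
      using sum half by (simp_all add: e)
    \<comment> \<open>A value k of \<open>(e + 1) div 2\<close> leaves only 2k - 1 and 2k for
      \<open>e\<close>. The parity of \<open>e\<close>, which is that of the common sum, decides
      between them.\<close>
    then have "even e \<longleftrightarrow> even e'" "(e + 1) div 2 = (e' + 1) div 2"
      by (metis even_add dvd_triv_left, simp)
    then have "e = e'"
      by (auto elim!: evenE oddE)
    with sum e show ?thesis by simp
  qed
qed

lemma V_Nil [simp]: "V [] = []"
  by (simp add: V_def pad_even_def)

lemma V_single [simp]: "V [a] = replicate a 1"
  by (simp add: V_def pad_even_def)

text \<open>Two extra entries keep the parity of the length, so the padding is unaffected, and the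
  remaining pair indices shift by one. This replaces indexing by a recursion.\<close>

lemma V_Cons_Cons [simp]: "V (a # b # c) = block a b @ V c"
proof -
  have pad: "pad_even (a # b # c) = a # b # pad_even c"
    by (simp add: pad_even_def)
  show ?thesis
    unfolding V_def Let_def pad
    by (simp add: upt_conv_Cons map_Suc_upt[symmetric] comp_def del: upt_Suc)
qed

lemma V_pos_sum:
  assumes "\<forall>x\<in>set c. 0 < x"
  shows "(\<forall>x\<in>set (V c). 0 < x) \<and> sum_list (V c) = sum_list c"
  using assms
proof (induction c rule: induct_list012)
  case (3 a b c)
  then show ?case
    using big_part_gt_1[of b a] run_add_big_part[of a b]
    by (auto simp: block_eq_run sum_list_replicate)
qed (auto simp: sum_list_replicate)

text \<open>Induction removes one pair at a time: the first part above 1 closes the first block,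
  which determines the pair, and cancelling the block leaves the images of the tails.\<close>

lemma V_inject:
  assumes "\<forall>x\<in>set c. 0 < x" "\<forall>x\<in>set d. 0 < x" "V c = V d"
  shows "c = d"
  using assms
proof (induction c arbitrary: d rule: induct_list012)
  case 1
  then show ?case
    \<comment> \<open>\<open>remdups_adj.cases\<close> serves only as a split into lists of length
      zero, one and at least two, matching \<open>induct_list012\<close>.\<close>
    by (cases d rule: remdups_adj.cases) (auto simp: block_eq_run)
next
  case (2 a)
  show ?case
  proof (cases d rule: remdups_adj.cases)
    case (3 a' b' d')
    then have "V d = replicate (run a' b') 1 @ big_part a' b' # V d'" "big_part a' b' \<noteq> 1"
      using 2 big_part_gt_1[of b' a'] by (auto simp: block_eq_run)
    then show ?thesis
      using 2 by (simp add: replicate_append_Cons_neq_replicate[symmetric] del: V_Cons_Cons)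
  qed (use 2 in auto)
next
  case (3 a b c)
  have c: "V (a # b # c) = replicate (run a b) 1 @ big_part a b # V c" "big_part a b \<noteq> 1"
    using 3 big_part_gt_1[of b a] by (auto simp: block_eq_run)
  show ?case
  proof (cases d rule: remdups_adj.cases)
    case 1
    then show ?thesis using "3.prems"(3) c by simp
  next
    case (2 a')
    then show ?thesis
      using "3.prems"(3) c by (simp add: replicate_append_Cons_neq_replicate del: V_Cons_Cons)
  next
    case d: (3 a' b' d')
    then have "V d = replicate (run a' b') 1 @ big_part a' b' # V d'" "big_part a' b' \<noteq> 1"
      using 3 big_part_gt_1[of b' a'] by (auto simp: block_eq_run)
    with c "3.prems"(3)
    have eq: "run a b = run a' b'" "big_part a b = big_part a' b'" "V c = V d'"
      by (auto simp: replicate_append_Cons_eq_iff simp del: V_Cons_Cons)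
    have "c = d'"
      using "3.prems" d eq(3) by (intro "3.IH"(1)) auto
    moreover have "a = a' \<and> b = b'"
      using "3.prems" d eq by (intro run_big_part_inject) auto
    ultimately show ?thesis
      using d by simp
  qed
qed

theorem theorem3p4:
  fixes n :: nat
  assumes "n \<ge> 1"
  shows "bij_betw V (compositions n) (compositions n)"
proof -
  have "V ` compositions n \<subseteq> compositions n"
    using V_pos_sum by (auto simp: compositions_def)
  moreover have "inj_on V (compositions n)"
    using V_inject by (auto simp: inj_on_def compositions_def)
  ultimately show ?thesis
    by (simp add: bij_betw_def endo_inj_surj finite_compositions)
qed

end
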